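(* Let $\gamma\ge 0$, let $P(\rho)=\ln\rho$ if $\gamma=0$ and $P(\rho)=\rho^\gamma/\gamma$ if $\gamma>0$, let $a$ be a continuously differentiable real function, and consider, for $\rho>0$, the system $$ \begin{cases} \partial_t \rho + \partial_x\big(\rho\, v(\rho,z,w) \big)=0,\\ \partial_t z+\partial_x \big(z\, v(\rho,z,w)\big)=0, \\ \partial_t w +\partial_x \big(w\, v(\rho,z,w)\big)=0 \end{cases} \qquad\text{with}\qquad v(\rho,z,w)=\frac{z}{\rho}-a\Big(\frac{w}{\rho}\Big)P(\rho). $$ Let $F\in C^2(\mathbb{R}^2)$ be any strictly convex function. Then the functions $$ \eta(\rho,z,w)=\rho\, F\left(\frac{z}{\rho},\frac{w}{\rho}\right)\quad\text{and}\quad \psi(\rho,z,w)=v(\rho,z,w)\,\eta(\rho,z,w) $$ form a semi-convex entropy-entropy flux pair that satisfies the entropy equation exactly, i.e. $\partial_t \eta(\rho,z,w) + \partial_x \psi(\rho,z,w)=0$ for smooth solutions. In particular, writing $\omega=z/\rho$ and $h=w/\rho$, the choices $$F(\omega,h)=\widetilde{F}(\omega), \qquad F(\omega,h)=\widetilde{F}(h),\qquad F(\omega,h)=\tfrac{1}{2}\omega^2+E(h),$$ the last of which gives $\eta(\rho,z,w) = \frac{z^2}{2\rho} + \rho\, E\big( \frac{w}{\rho} \big)$, yield semi-convex entropies for all strictly convex functions $\widetilde{F}, E \in C^2(\mathbb{R})$.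
   Context: "Semi-convex" means that the Hessian of $\eta$ with respect to $(\rho,z,w)$ is positive semidefinite, i.e. $\xi^T\nabla^2\eta\,\xi\ge 0$ for all $\xi\in\mathbb{R}^3$, at every state with $\rho>0$. *)

theory Defs
  imports "HOL-Analysis.Analysis"
begin

text \<open>Smoothness on an open set, expressed by continuity of the Frechet derivative in operator norm.\<close>

definition C1_on :: "('a::real_normed_vector \<Rightarrow> 'b::real_normed_vector) \<Rightarrow> 'a set \<Rightarrow> bool" where
  "C1_on f S \<longleftrightarrow>
     (\<exists>f'::'a \<Rightarrow> 'a \<Rightarrow>\<^sub>L 'b.
        (\<forall>x\<in>S. (f has_derivative blinfun_apply (f' x)) (at x)) \<and> continuous_on S f')"

definition C2_on :: "('a::real_normed_vector \<Rightarrow> 'b::real_normed_vector) \<Rightarrow> 'a set \<Rightarrow> bool" where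
  "C2_on f S \<longleftrightarrow>
     (\<exists>f'::'a \<Rightarrow> 'a \<Rightarrow>\<^sub>L 'b.
        (\<forall>x\<in>S. (f has_derivative blinfun_apply (f' x)) (at x)) \<and> C1_on f' S)"

definition strictly_convex :: "('a::real_vector \<Rightarrow> real) \<Rightarrow> bool" where
  "strictly_convex F \<longleftrightarrow>
     (\<forall>x y t. x \<noteq> y \<longrightarrow> 0 < t \<longrightarrow> t < 1 \<longrightarrow>
        F ((1 - t) *\<^sub>R x + t *\<^sub>R y) < (1 - t) * F x + t * F y)"

definition partial_deriv :: "'n::finite \<Rightarrow> (real ^ 'n \<Rightarrow> real) \<Rightarrow> real ^ 'n \<Rightarrow> real" where
  "partial_deriv i f u = deriv (\<lambda>s. f (u + s *\<^sub>R axis i 1)) 0"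

definition hessian :: "(real ^ 'n::finite \<Rightarrow> real) \<Rightarrow> real ^ 'n \<Rightarrow> real ^ 'n ^ 'n" where
  "hessian f u = (\<chi> i j. partial_deriv i (partial_deriv j f) u)"

text \<open>
  The regularity clause ensures that the partial derivatives in \<^const>\<open>hessian\<close> exist, so that the
  second clause does not speak about unspecified values of \<^const>\<open>deriv\<close>.
\<close>

definition semi_convex_on :: "(real ^ 'n::finite \<Rightarrow> real) \<Rightarrow> (real ^ 'n) set \<Rightarrow> bool" where
  "semi_convex_on \<eta> S \<longleftrightarrow>
     C2_on \<eta> S \<and> (\<forall>u\<in>S. \<forall>\<xi>. 0 \<le> \<xi> \<bullet> (hessian \<eta> u *v \<xi>))"

text \<open>
  The compatibility relation \<open>\<nabla>\<psi>(u)\<^sup>T = \<nabla>\<eta>(u)\<^sup>T Df(u)\<close> for the system \<open>\<partial>\<^sub>t u + \<partial>\<^sub>x f(u) = 0\<close>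
  with state space \<open>S\<close>.
\<close>

definition entropy_pair ::
  "(real ^ 'n::finite \<Rightarrow> real ^ 'n) \<Rightarrow> (real ^ 'n) set \<Rightarrow>
     (real ^ 'n \<Rightarrow> real) \<Rightarrow> (real ^ 'n \<Rightarrow> real) \<Rightarrow> bool" where
  "entropy_pair f S \<eta> \<psi> \<longleftrightarrow>
     (\<forall>u\<in>S. \<exists>Df D\<eta>. (f has_derivative Df) (at u) \<and> (\<eta> has_derivative D\<eta>) (at u) \<and>
        (\<psi> has_derivative (D\<eta> \<circ> Df)) (at u))"

text \<open>Points of space-time are pairs \<open>(t, x)\<close>; the equation is \<open>\<partial>\<^sub>t q + \<partial>\<^sub>x j = 0\<close> on \<open>\<Omega>\<close>.\<close>

definition balance_eq ::
  "(real \<times> real) set \<Rightarrow> (real \<times> real \<Rightarrow> 'a::real_normed_vector) \<Rightarrow> (real \<times> real \<Rightarrow> 'a) \<Rightarrow> bool" where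
  "balance_eq \<Omega> q j \<longleftrightarrow>
     (\<forall>(t, x)\<in>\<Omega>. \<exists>qt jx.
        ((\<lambda>s. q (s, x)) has_vector_derivative qt) (at t) \<and>
        ((\<lambda>y. j (t, y)) has_vector_derivative jx) (at x) \<and>
        qt + jx = 0)"

definition smooth_solution ::
  "(real ^ 'n::finite \<Rightarrow> real ^ 'n) \<Rightarrow> (real ^ 'n) set \<Rightarrow>
     (real \<times> real) set \<Rightarrow> (real \<times> real \<Rightarrow> real ^ 'n) \<Rightarrow> bool" where
  "smooth_solution f S \<Omega> U \<longleftrightarrow>
     open \<Omega> \<and> C1_on U \<Omega> \<and> U ` \<Omega> \<subseteq> S \<and> balance_eq \<Omega> U (\<lambda>p. f (U p))"

definition satisfies_entropy_eq ::
  "(real ^ 'n::finite \<Rightarrow> real ^ 'n) \<Rightarrow> (real ^ 'n) set \<Rightarrow>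
     (real ^ 'n \<Rightarrow> real) \<Rightarrow> (real ^ 'n \<Rightarrow> real) \<Rightarrow> bool" where
  "satisfies_entropy_eq f S \<eta> \<psi> \<longleftrightarrow>
     (\<forall>\<Omega> U. smooth_solution f S \<Omega> U \<longrightarrow> balance_eq \<Omega> (\<lambda>p. \<eta> (U p)) (\<lambda>p. \<psi> (U p)))"

text \<open>States are \<open>u = (\<rho>, z, w)\<close>, i.e. \<open>u $ 1 = \<rho>\<close>, \<open>u $ 2 = z\<close>, \<open>u $ 3 = w\<close>.\<close>

definition states :: "(real ^ 3) set" where
  "states = {u. u $ 1 > 0}"

definition P :: "real \<Rightarrow> real \<Rightarrow> real" where
  "P \<gamma> \<rho> = (if \<gamma> = 0 then ln \<rho> else \<rho> powr \<gamma> / \<gamma>)"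

definition v :: "real \<Rightarrow> (real \<Rightarrow> real) \<Rightarrow> real ^ 3 \<Rightarrow> real" where
  "v \<gamma> a u = u $ 2 / u $ 1 - a (u $ 3 / u $ 1) * P \<gamma> (u $ 1)"

text \<open>All three densities are transported with the same velocity: the flux is \<open>(\<rho> v, z v, w v)\<close>.\<close>

definition flux :: "real \<Rightarrow> (real \<Rightarrow> real) \<Rightarrow> real ^ 3 \<Rightarrow> real ^ 3" where
  "flux \<gamma> a u = v \<gamma> a u *\<^sub>R u"

definition \<eta> :: "(real \<times> real \<Rightarrow> real) \<Rightarrow> real ^ 3 \<Rightarrow> real" where
  "\<eta> F u = u $ 1 * F (u $ 2 / u $ 1, u $ 3 / u $ 1)"

definition \<psi> :: "real \<Rightarrow> (real \<Rightarrow> real) \<Rightarrow> (real \<times> real \<Rightarrow> real) \<Rightarrow> real ^ 3 \<Rightarrow> real" where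
  "\<psi> \<gamma> a F u = v \<gamma> a u * \<eta> F u"

definition exact_semi_convex_entropy ::
  "real \<Rightarrow> (real \<Rightarrow> real) \<Rightarrow> (real \<times> real \<Rightarrow> real) \<Rightarrow> bool" where
  "exact_semi_convex_entropy \<gamma> a F \<longleftrightarrow>
     semi_convex_on (\<eta> F) states \<and>
     entropy_pair (flux \<gamma> a) states (\<eta> F) (\<psi> \<gamma> a F) \<and>
     satisfies_entropy_eq (flux \<gamma> a) states (\<eta> F) (\<psi> \<gamma> a F)"

end

theory Submission
  imports Defs
begin

text \<open>
  The entropy \<open>\<eta>\<close> is homogeneous of degree one and the flux is \<open>v(u) u\<close>, so Euler's identity
  \<open>D\<eta>(u) u = \<eta>(u)\<close> gives \<open>D\<eta> (v h + (Dv h) u) = v D\<eta> h + (Dv h) \<eta> = D(v \<eta>) h\<close>, which is the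
  compatibility relation, whatever \<open>v\<close> is. Moreover \<open>\<eta>\<close> is the perspective of \<open>F\<close>, so it is convex
  as soon as \<open>F\<close> is, and a convex \<open>C\<^sup>2\<close> function has a positive semidefinite Hessian. Mere convexity
  of \<open>F\<close> suffices; this covers the choices depending on one variable only, which are not strictly
  convex on the plane.
\<close>

subsection \<open>Calculus of \<open>C\<^sup>1\<close> and \<open>C\<^sup>2\<close> functions\<close>

lemma C1_onI:
  assumes "\<And>x. x \<in> S \<Longrightarrow> (f has_derivative blinfun_apply (f' x)) (at x)" "continuous_on S f'"
  shows "C1_on f S"
  using assms unfolding C1_on_def by blast

lemma C2_onI:
  assumes "\<And>x. x \<in> S \<Longrightarrow> (f has_derivative blinfun_apply (f' x)) (at x)" "C1_on f' S"
  shows "C2_on f S"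
  using assms unfolding C2_on_def by blast

lemma C1_on_const: "C1_on (\<lambda>x. c) S"
  unfolding C1_on_def by (intro exI[of _ "\<lambda>x. 0"]) (auto simp: zero_blinfun.rep_eq)

lemma C1_imp_continuous_on: "C1_on f S \<Longrightarrow> continuous_on S f"
  unfolding C1_on_def continuous_on_eq_continuous_within
  by (blast intro: has_derivative_at_withinI has_derivative_continuous)

lemma C2_imp_C1:
  assumes "C2_on f S" shows "C1_on f S"
proof -
  from assms obtain f' where f': "\<forall>x\<in>S. (f has_derivative blinfun_apply (f' x)) (at x)" and "C1_on f' S"
    unfolding C2_on_def by blast
  from \<open>C1_on f' S\<close> have "continuous_on S f'"
    by (rule C1_imp_continuous_on)
  with f' show ?thesis
    unfolding C1_on_def by blast
qed

lemma C1_imp_has_derivative: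
  assumes "C1_on f S" "x \<in> S"
  obtains D where "(f has_derivative D) (at x)"
  using assms unfolding C1_on_def by blast

lemma C2_on_linear:
  assumes "bounded_linear f" shows "C2_on f S"
  unfolding C2_on_def
  by (intro exI[of _ "\<lambda>x. Blinfun f"])
    (auto simp: assms bounded_linear_Blinfun_apply C1_on_const bounded_linear_imp_has_derivative)

lemma C2_on_const: "C2_on (\<lambda>x. c) S"
  unfolding C2_on_def by (intro exI[of _ "\<lambda>x. 0"]) (auto simp: C1_on_const zero_blinfun.rep_eq)

lemma C1_on_add:
  assumes "C1_on f S" "C1_on g S"
  shows "C1_on (\<lambda>x. f x + g x) S"
proof -
  from assms obtain f' g' where "\<forall>x\<in>S. (f has_derivative blinfun_apply (f' x)) (at x)"
    "continuous_on S f'" "\<forall>x\<in>S. (g has_derivative blinfun_apply (g' x)) (at x)"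
    "continuous_on S g'"
    unfolding C1_on_def by blast
  then show ?thesis
    unfolding C1_on_def
    by (intro exI[of _ "\<lambda>x. f' x + g' x"])
      (auto simp: plus_blinfun.rep_eq intro!: has_derivative_add continuous_on_add)
qed

text \<open>Keeping the chain rule at the level of bounded operators lets the regularity of the
  derivative be read off from operator composition.\<close>

lemma has_derivative_compose_blinfun:
  assumes "(g has_derivative blinfun_apply g') (at x)"
    "(f has_derivative blinfun_apply f') (at (g x))"
  shows "((\<lambda>x. f (g x)) has_derivative blinfun_apply (f' o\<^sub>L g')) (at x)"
  by (rule has_derivative_eq_rhs[OF has_derivative_compose[OF assms]]) (simp add: fun_eq_iff)

lemma C1_on_compose:
  assumes "C1_on f T" "C1_on g S" "g ` S \<subseteq> T"
  shows "C1_on (\<lambda>x. f (g x)) S"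
proof -
  from assms obtain f' g'
    where f': "\<forall>x\<in>T. (f has_derivative blinfun_apply (f' x)) (at x)" "continuous_on T f'"
      and g': "\<forall>x\<in>S. (g has_derivative blinfun_apply (g' x)) (at x)" "continuous_on S g'"
    unfolding C1_on_def by blast
  have "continuous_on S (\<lambda>x. f' (g x))"
    using f'(2) C1_imp_continuous_on[OF assms(2)] assms(3) by (rule continuous_on_compose2)
  then have D: "continuous_on S (\<lambda>x. f' (g x) o\<^sub>L g' x)"
    using g'(2) by (intro continuous_intros)
  have deriv: "((\<lambda>x. f (g x)) has_derivative blinfun_apply (f' (g x) o\<^sub>L g' x)) (at x)"
    if "x \<in> S" for x
    by (rule has_derivative_compose_blinfun) (use that f'(1) g'(1) assms(3) in auto)
  show ?thesis
    by (rule C1_onI[OF deriv D])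
qed

text \<open>Since \<open>prod_left\<close> and \<open>prod_right\<close> are bounded linear in the
  values \<open>g x\<close> and \<open>f x\<close>, this form of the product rule reduces the
  regularity of the derivative to that of \<open>f\<close>, \<open>g\<close> and their
  derivatives.\<close>

lemma (in bounded_bilinear) has_derivative_blinfun:
  assumes "(f has_derivative blinfun_apply f') (at x)" "(g has_derivative blinfun_apply g') (at x)"
  shows "((\<lambda>x. prod (f x) (g x)) has_derivative
    blinfun_apply ((prod_right (f x) o\<^sub>L g') + (prod_left (g x) o\<^sub>L f'))) (at x)"
  by (rule has_derivative_eq_rhs[OF FDERIV[OF assms]])
    (simp add: fun_eq_iff blinfun.add_left prod_left.rep_eq prod_right.rep_eq)

text \<open>The general bilinear setting serves both real multiplication and composition of
  operators; the latter is what differentiating a chain-rule derivative once more requires.\<close>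

lemma (in bounded_bilinear) C1_on:
  assumes "C1_on f S" "C1_on g S"
  shows "C1_on (\<lambda>x. prod (f x) (g x)) S"
proof -
  from assms obtain f' g'
    where f': "\<forall>x\<in>S. (f has_derivative blinfun_apply (f' x)) (at x)" "continuous_on S f'"
      and g': "\<forall>x\<in>S. (g has_derivative blinfun_apply (g' x)) (at x)" "continuous_on S g'"
    unfolding C1_on_def by blast
  let ?D = "\<lambda>x. (prod_right (f x) o\<^sub>L g' x) + (prod_left (g x) o\<^sub>L f' x)"
  note cont = bounded_linear.continuous_on[OF bounded_linear_prod_right C1_imp_continuous_on[OF assms(1)]]
    bounded_linear.continuous_on[OF bounded_linear_prod_left C1_imp_continuous_on[OF assms(2)]]
  have D: "continuous_on S ?D"
    by (rule continuous_on_add; rule bounded_bilinear.continuous_on[OF bounded_bilinear_blinfun_compose];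
        rule cont f'(2) g'(2))
  have deriv: "((\<lambda>x. prod (f x) (g x)) has_derivative blinfun_apply (?D x)) (at x)"
    if "x \<in> S" for x
    by (rule has_derivative_blinfun) (use that f'(1) g'(1) in auto)
  show ?thesis
    by (rule C1_onI[where f' = ?D, OF deriv D])
qed

lemmas C1_on_blinfun_compose = bounded_bilinear.C1_on[OF bounded_bilinear_blinfun_compose]

lemma (in bounded_linear) C1_on:
  assumes "C1_on g S" shows "C1_on (\<lambda>x. f (g x)) S"
  using C2_imp_C1[OF C2_on_linear[OF bounded_linear_axioms]] assms subset_UNIV
  by (rule C1_on_compose)

lemma C2_on_add:
  assumes "C2_on f S" "C2_on g S"
  shows "C2_on (\<lambda>x. f x + g x) S"
proof -
  from assms obtain f' g' where "\<forall>x\<in>S. (f has_derivative blinfun_apply (f' x)) (at x)"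
    "C1_on f' S" "\<forall>x\<in>S. (g has_derivative blinfun_apply (g' x)) (at x)" "C1_on g' S"
    unfolding C2_on_def by blast
  then show ?thesis
    unfolding C2_on_def
    by (intro exI[of _ "\<lambda>x. f' x + g' x"])
      (auto simp: plus_blinfun.rep_eq intro!: has_derivative_add C1_on_add)
qed

text \<open>The derivative is the operator product of \<open>f' (g x)\<close> and
  \<open>g' x\<close>; both factors are \<open>C1_on\<close>, hence so is their product.\<close>

lemma C2_on_compose:
  assumes "C2_on f T" "C2_on g S" "g ` S \<subseteq> T"
  shows "C2_on (\<lambda>x. f (g x)) S"
proof -
  from assms obtain f' g'
    where f': "\<forall>x\<in>T. (f has_derivative blinfun_apply (f' x)) (at x)" "C1_on f' T"
      and g': "\<forall>x\<in>S. (g has_derivative blinfun_apply (g' x)) (at x)" "C1_on g' S"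
    unfolding C2_on_def by blast
  have D: "C1_on (\<lambda>x. f' (g x) o\<^sub>L g' x) S"
    using C1_on_compose[OF f'(2) C2_imp_C1[OF assms(2)] assms(3)] g'(2)
    by (rule C1_on_blinfun_compose)
  have deriv: "((\<lambda>x. f (g x)) has_derivative blinfun_apply (f' (g x) o\<^sub>L g' x)) (at x)"
    if "x \<in> S" for x
    by (rule has_derivative_compose_blinfun) (use that f'(1) g'(1) assms(3) in auto)
  show ?thesis
    by (rule C2_onI[OF deriv D])
qed

lemma (in bounded_bilinear) C2_on:
  assumes "C2_on f S" "C2_on g S"
  shows "C2_on (\<lambda>x. prod (f x) (g x)) S"
proof -
  from assms obtain f' g'
    where f': "\<forall>x\<in>S. (f has_derivative blinfun_apply (f' x)) (at x)" "C1_on f' S"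
      and g': "\<forall>x\<in>S. (g has_derivative blinfun_apply (g' x)) (at x)" "C1_on g' S"
    unfolding C2_on_def by blast
  let ?D = "\<lambda>x. (prod_right (f x) o\<^sub>L g' x) + (prod_left (g x) o\<^sub>L f' x)"
  have D: "C1_on ?D S"
    by (rule C1_on_add; rule C1_on_blinfun_compose;
        rule bounded_linear.C1_on[OF bounded_linear_prod_right C2_imp_C1[OF assms(1)]]
          bounded_linear.C1_on[OF bounded_linear_prod_left C2_imp_C1[OF assms(2)]] f'(2) g'(2))
  have deriv: "((\<lambda>x. prod (f x) (g x)) has_derivative blinfun_apply (?D x)) (at x)"
    if "x \<in> S" for x
    by (rule has_derivative_blinfun) (use that f'(1) g'(1) in auto)
  show ?thesis
    by (rule C2_onI[where f' = ?D, OF deriv D])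
qed

text \<open>A bootstrap: the derivative is minus the square of \<open>inverse\<close> itself. Its
  continuity makes \<open>inverse\<close> a \<open>C1_on\<close> function, and then the derivative,
  as a product of such functions, is \<open>C1_on\<close> too.\<close>

lemma C2_on_inverse: "C2_on (inverse :: real \<Rightarrow> real) {0<..}"
proof -
  let ?D = "\<lambda>x::real. blinfun_scaleR_left (- (inverse x * inverse x))"
  have deriv: "(inverse has_derivative blinfun_apply (?D x)) (at x)" if "x \<in> {0<..}" for x :: real
    using that by (auto intro!: derivative_eq_intros simp: fun_eq_iff)
  \<comment> \<open>The operator depends linearly on its scalar coefficient, so regularity of the
    coefficient carries over to \<open>?D\<close>.\<close>
  have lin: "bounded_linear (\<lambda>x::real. blinfun_scaleR_left (- x))"
    by (intro bounded_linear_compose[OF bounded_linear_blinfun_scaleR_left]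
        bounded_linear_minus bounded_linear_ident)
  have "continuous_on {0<..} ?D"
    by (rule bounded_linear.continuous_on[OF lin]) (auto intro!: continuous_intros)
  with deriv have C1: "C1_on (inverse :: real \<Rightarrow> real) {0<..}"
    by (rule C1_onI)
  have "C1_on ?D {0<..}"
    using bounded_bilinear.C1_on[OF bounded_bilinear_mult C1 C1] by (rule bounded_linear.C1_on[OF lin])
  with deriv show ?thesis
    by (rule C2_onI)
qed

subsection \<open>Second-order characterization of convexity\<close>

text \<open>Restriction to a line gives access to one-variable calculus; tangent inequalities,
  partial derivatives and Euler's identity all pass through it.\<close>

lemma has_derivative_imp_deriv_line:
  fixes f :: "'a::real_normed_vector \<Rightarrow> real"
  assumes "(f has_derivative D) (at u)"
  shows "((\<lambda>s. f (u + s *\<^sub>R \<xi>)) has_real_derivative D \<xi>) (at 0)"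
proof -
  have "((\<lambda>s. f (u + s *\<^sub>R \<xi>)) has_derivative (\<lambda>h. D (h *\<^sub>R \<xi>))) (at 0)"
    using assms
    by (auto intro!: derivative_eq_intros has_derivative_compose[of "\<lambda>t. u + t *\<^sub>R \<xi>" _ _ _ f])
  then show ?thesis
    by (rule has_derivative_imp_has_field_derivative)
      (metis assms has_derivative_linear linear_scale mult.commute real_scaleR_def)
qed

lemma convex_on_above_tangent:
  assumes "convex_on S f" "(f has_derivative D) (at x)" "x \<in> S" "y \<in> S"
  shows "D (y - x) \<le> f y - f x"
proof -
  define g where "g t = f (x + t *\<^sub>R (y - x))" for t :: real
  have seg: "x + t *\<^sub>R (y - x) = (1 - t) *\<^sub>R x + t *\<^sub>R y" for t
    by (simp add: algebra_simps)
  have "g t \<le> g 0 + t * (g 1 - g 0)" if "0 \<le> t" "t \<le> 1" for t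
    using convex_onD[OF assms(1) that assms(3,4)] by (simp add: g_def seg algebra_simps)
  have "(g has_real_derivative D (y - x)) (at 0)"
    unfolding g_def using assms(2) by (rule has_derivative_imp_deriv_line)
  \<comment> \<open>After subtraction of the chord slope, convexity bounds the function by
    \<open>g 0\<close> on the unit interval, so its derivative at 0 cannot be positive.\<close>
  then have d: "((\<lambda>t. g t - t * (g 1 - g 0)) has_real_derivative D (y - x) - (g 1 - g 0)) (at 0)"
    by (auto intro!: derivative_eq_intros)
  show ?thesis
  proof (rule ccontr)
    assume "\<not> ?thesis"
    then have "D (y - x) - (g 1 - g 0) > 0" by (simp add: g_def)
    from has_real_derivative_pos_inc_right[OF d this] obtain e where e: "e > 0"
      "\<And>h. h > 0 \<Longrightarrow> h < e \<Longrightarrow> g 0 < g h - h * (g 1 - g 0)" by auto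
    \<comment> \<open>Below \<open>e\<close> the strict increase applies, and up to 1 the convexity
      bound does.\<close>
    define h where "h = min (e / 2) 1"
    have "0 < h" "h < e" "h \<le> 1" using e by (auto simp: h_def)
    with e(2)[of h] \<open>\<And>t. 0 \<le> t \<Longrightarrow> t \<le> 1 \<Longrightarrow> g t \<le> g 0 + t * (g 1 - g 0)\<close>[of h]
    show False by simp
  qed
qed

text \<open>A negative value would make the slope in direction \<open>\<xi>\<close> drop strictly
  just after \<open>u\<close>, while the tangent inequalities at two points of the line force this
  slope to be nondecreasing.\<close>

lemma convex_imp_second_derivative_nonneg:
  assumes S: "open S" "convex_on S f" "u \<in> S"
    and f': "\<And>x. x \<in> S \<Longrightarrow> (f has_derivative blinfun_apply (f' x)) (at x)"
    and f'': "(f' has_derivative f'') (at u)"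
  shows "0 \<le> blinfun_apply (f'' \<xi>) \<xi>"
proof (rule ccontr)
  assume neg: "\<not> ?thesis"
  have "((\<lambda>x. blinfun_apply (f' x) \<xi>) has_derivative (\<lambda>h. blinfun_apply (f'' h) \<xi>)) (at u)"
    using f'' by (auto intro!: derivative_eq_intros)
  from has_derivative_imp_deriv_line[OF this]
  have d: "((\<lambda>s. blinfun_apply (f' (u + s *\<^sub>R \<xi>)) \<xi>) has_real_derivative f'' \<xi> \<xi>) (at 0)" .
  from has_real_derivative_neg_dec_right[OF d] neg obtain e where e: "e > 0"
    "\<And>h. h > 0 \<Longrightarrow> h < e \<Longrightarrow> f' (u + h *\<^sub>R \<xi>) \<xi> < f' u \<xi>" by auto
  have "((\<lambda>s. u + s *\<^sub>R \<xi>) \<longlongrightarrow> u) (at_right (0::real))"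
    by (auto intro!: tendsto_eq_intros)
  then have "\<forall>\<^sub>F s in at_right (0::real). u + s *\<^sub>R \<xi> \<in> S"
    using S(1,3) by (rule topological_tendstoD)
  moreover have "\<forall>\<^sub>F s in at_right 0. s \<in> {0<..<e}"
    using e(1) by (rule eventually_at_right_real)
  ultimately have "\<forall>\<^sub>F s in at_right (0::real). u + s *\<^sub>R \<xi> \<in> S \<and> s \<in> {0<..<e}"
    by eventually_elim auto
  then obtain s where s: "u + s *\<^sub>R \<xi> \<in> S" "0 < s" "s < e"
    using eventually_happens'[OF trivial_limit_at_right_real[of "0::real"]] by auto
  have "s * f' u \<xi> \<le> f (u + s *\<^sub>R \<xi>) - f u"
    using convex_on_above_tangent[OF S(2) f'[OF S(3)] S(3) s(1)] by (simp add: blinfun.scaleR_right)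
  \<comment> \<open>This is the tangent at the shifted point, looking back to \<open>u\<close>;
    adding it to the previous inequality cancels the values of \<open>f\<close>.\<close>
  moreover have "- (s * f' (u + s *\<^sub>R \<xi>) \<xi>) \<le> f u - f (u + s *\<^sub>R \<xi>)"
    using convex_on_above_tangent[OF S(2) f'[OF s(1)] s(1) S(3)]
    by (simp add: blinfun.scaleR_right blinfun.minus_right)
  ultimately have "s * f' u \<xi> \<le> s * f' (u + s *\<^sub>R \<xi>) \<xi>" by simp
  with e(2)[of s] s show False by simp
qed

section \<open>The Hessian matrix and the second Frechet derivative\<close>

lemma partial_deriv_eq:
  assumes "(f has_derivative D) (at u)"
  shows "partial_deriv i f u = D (axis i 1)"
  unfolding partial_deriv_def using has_derivative_imp_deriv_line[OF assms] by (rule DERIV_imp_deriv)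

text \<open>The outer partial derivative, with index \<open>i\<close>, differentiates
  \<open>f'\<close> itself, and \<open>j\<close> is the direction in which \<open>f'\<close> is
  evaluated; hence the order of the arguments of \<open>f''\<close>.\<close>

lemma hessian_component:
  assumes S: "open S" "u \<in> S"
    and f': "\<And>x. x \<in> S \<Longrightarrow> (f has_derivative blinfun_apply (f' x)) (at x)"
    and f'': "(f' has_derivative f'') (at u)"
  shows "hessian f u $ i $ j = blinfun_apply (f'' (axis i 1)) (axis j 1)"
proof -
  have "((\<lambda>x. blinfun_apply (f' x) (axis j 1)) has_derivative (\<lambda>h. f'' h (axis j 1))) (at u)"
    using f'' by (auto intro!: derivative_eq_intros)
  \<comment> \<open>The first partial derivative is given by \<open>f'\<close> on all of the open
    set \<open>S\<close>, not just at \<open>u\<close>, so it may be differentiated again.\<close>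
  then have "(partial_deriv j f has_derivative (\<lambda>h. f'' h (axis j 1))) (at u)"
    using S by (rule has_derivative_transform_within_open) (simp add: partial_deriv_eq[OF f'])
  then show ?thesis
    by (simp add: hessian_def partial_deriv_eq)
qed

lemma hessian_quadratic_form:
  assumes "open S" "u \<in> S"
    and "\<And>x. x \<in> S \<Longrightarrow> (f has_derivative blinfun_apply (f' x)) (at x)"
    and f'': "(f' has_derivative f'') (at u)"
  shows "\<xi> \<bullet> (hessian f u *v \<xi>) = blinfun_apply (f'' \<xi>) \<xi>"
proof -
  interpret bounded_linear f'' using f'' by (rule has_derivative_bounded_linear)
  have \<xi>: "\<xi> = (\<Sum>i\<in>UNIV. \<xi> $ i *\<^sub>R axis i 1)"
    using basis_expansion[of \<xi>] by (simp add: scalar_mult_eq_scaleR)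
  have "blinfun_apply (f'' \<xi>) \<xi> =
      blinfun_apply (f'' (\<Sum>i\<in>UNIV. \<xi> $ i *\<^sub>R axis i 1)) (\<Sum>j\<in>UNIV. \<xi> $ j *\<^sub>R axis j 1)"
    using \<xi> by simp
  also have "\<dots> = (\<Sum>j\<in>UNIV. \<Sum>i\<in>UNIV. \<xi> $ i * (f'' (axis i 1) (axis j 1) * \<xi> $ j))"
    by (simp add: sum scaleR blinfun.sum_left blinfun.sum_right blinfun.scaleR_left
        blinfun.scaleR_right sum_distrib_left mult_ac)
  \<comment> \<open>The row index goes outside, as in the inner product with a matrix-vector
    product.\<close>
  also have "\<dots> = (\<Sum>i\<in>UNIV. \<Sum>j\<in>UNIV. \<xi> $ i * (f'' (axis i 1) (axis j 1) * \<xi> $ j))"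
    by (rule sum.swap)
  finally show ?thesis
    by (simp add: inner_vec_def matrix_vector_mult_def sum_distrib_left hessian_component[OF assms])
qed

lemma convex_imp_semi_convex_on:
  assumes "open S" "convex_on S f" "C2_on f S"
  shows "semi_convex_on f S"
proof -
  from \<open>C2_on f S\<close> obtain f'
    where f': "\<And>x. x \<in> S \<Longrightarrow> (f has_derivative blinfun_apply (f' x)) (at x)" and "C1_on f' S"
    unfolding C2_on_def by blast
  have "0 \<le> \<xi> \<bullet> (hessian f u *v \<xi>)" if u: "u \<in> S" for u \<xi>
  proof -
    obtain f'' where f'': "(f' has_derivative f'') (at u)"
      using \<open>C1_on f' S\<close> u by (rule C1_imp_has_derivative)
    have "\<xi> \<bullet> (hessian f u *v \<xi>) = f'' \<xi> \<xi>"
      by (rule hessian_quadratic_form) fact+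
    moreover have "0 \<le> f'' \<xi> \<xi>"
      by (rule convex_imp_second_derivative_nonneg) fact+
    ultimately show ?thesis by simp
  qed
  with assms(3) show ?thesis
    unfolding semi_convex_on_def by blast
qed

subsection \<open>Entropy pairs and smooth solutions\<close>

lemma has_vector_derivative_chain:
  assumes "(X has_vector_derivative X') (at s)" "(g has_derivative G) (at (X s))"
  shows "((\<lambda>s. g (X s)) has_vector_derivative G X') (at s)"
proof -
  have "((\<lambda>s. g (X s)) has_derivative (\<lambda>h. G (h *\<^sub>R X'))) (at s)"
    using assms unfolding has_vector_derivative_def by (rule has_derivative_compose)
  then show ?thesis
    unfolding has_vector_derivative_def
    using linear_scale[OF has_derivative_linear[OF assms(2)]] by simp
qed

text \<open>By the chain rule the two terms of the entropy equation are \<open>De qt\<close> and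
  \<open>De (Df Ux)\<close>, where \<open>Ux\<close> is the space derivative of \<open>U\<close>.
  The second is \<open>De jx\<close>, so their sum is \<open>De\<close> applied to the conservation
  law.\<close>

lemma entropy_pair_imp_satisfies_entropy_eq:
  assumes "entropy_pair f S e q"
  shows "satisfies_entropy_eq f S e q"
  unfolding satisfies_entropy_eq_def
proof (intro allI impI)
  fix \<Omega> U
  assume sol: "smooth_solution f S \<Omega> U"
  show "balance_eq \<Omega> (\<lambda>p. e (U p)) (\<lambda>p. q (U p))"
    unfolding balance_eq_def
  proof clarify
    fix t x assume p: "(t, x) \<in> \<Omega>"
    obtain D where D: "(U has_derivative D) (at (t, x))"
      using sol p unfolding smooth_solution_def by (blast elim: C1_imp_has_derivative)
    obtain Df De where Df: "(f has_derivative Df) (at (U (t, x)))"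
      and De: "(e has_derivative De) (at (U (t, x)))"
      and Dq: "(q has_derivative (De \<circ> Df)) (at (U (t, x)))"
      using assms sol p unfolding entropy_pair_def smooth_solution_def by blast
    obtain qt jx where qt: "((\<lambda>s. U (s, x)) has_vector_derivative qt) (at t)"
      and jx: "((\<lambda>y. f (U (t, y))) has_vector_derivative jx) (at x)" and eq: "qt + jx = 0"
      using sol p unfolding smooth_solution_def balance_eq_def by blast
    have "((\<lambda>y. (t, y)) has_vector_derivative (0, 1)) (at x)"
      by (auto intro!: derivative_eq_intros simp: has_vector_derivative_def)
    then have Ux: "((\<lambda>y. U (t, y)) has_vector_derivative D (0, 1)) (at x)"
      using D by (rule has_vector_derivative_chain)
    \<comment> \<open>The solution only provides some derivative \<open>jx\<close> of the flux;
      uniqueness identifies it with the chain-rule value.\<close>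
    have "jx = Df (D (0, 1))"
      using vector_derivative_unique_at[OF jx has_vector_derivative_chain[OF Ux Df]] .
    then have "De qt + (De \<circ> Df) (D (0, 1)) = De (qt + jx)"
      using linear_add[OF has_derivative_linear[OF De]] by simp
    also have "\<dots> = 0"
      using linear_0[OF has_derivative_linear[OF De]] eq by simp
    finally show "\<exists>qt jx. ((\<lambda>s. e (U (s, x))) has_vector_derivative qt) (at t) \<and>
        ((\<lambda>y. q (U (t, y))) has_vector_derivative jx) (at x) \<and> qt + jx = 0"
      using has_vector_derivative_chain[OF qt De] has_vector_derivative_chain[OF Ux Dq] by blast
  qed
qed

text \<open>On the ray through \<open>u\<close> the function is \<open>(1 + s) * f u\<close>, whose
  slope is \<open>f u\<close>; the derivative \<open>D\<close> gives the same slope as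
  \<open>D u\<close>.\<close>

lemma euler_homogeneous:
  fixes f :: "'a::real_normed_vector \<Rightarrow> real"
  assumes "(f has_derivative D) (at u)" and "\<And>t. t > 0 \<Longrightarrow> f (t *\<^sub>R u) = t * f u"
  shows "D u = f u"
proof -
  have 1: "((\<lambda>s. f (u + s *\<^sub>R u)) has_real_derivative D u) (at 0)"
    using assms(1) by (rule has_derivative_imp_deriv_line)
  have "((\<lambda>s. (1 + s) * f u) has_real_derivative f u) (at 0)"
    by (auto intro!: derivative_eq_intros)
  then have "((\<lambda>s. f (u + s *\<^sub>R u)) has_real_derivative f u) (at 0)"
    \<comment> \<open>For \<open>s > -1\<close> the factor \<open>1 + s\<close> is positive, so
      homogeneity applies.\<close>
    by (rule has_field_derivative_transform_within_open[where S = "{-1<..}"])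
      (auto simp: assms(2)[symmetric] scaleR_left_distrib)
  with 1 show ?thesis by (rule DERIV_unique)
qed

lemma entropy_pair_transport:
  fixes c e :: "real ^ 'n::finite \<Rightarrow> real"
  assumes "\<And>u. u \<in> S \<Longrightarrow> c differentiable (at u)"
    and "\<And>u. u \<in> S \<Longrightarrow> e differentiable (at u)"
    and hom: "\<And>u t. u \<in> S \<Longrightarrow> t > 0 \<Longrightarrow> e (t *\<^sub>R u) = t * e u"
  shows "entropy_pair (\<lambda>u. c u *\<^sub>R u) S e (\<lambda>u. c u * e u)"
  unfolding entropy_pair_def
proof
  fix u assume u: "u \<in> S"
  obtain Dc De where Dc: "(c has_derivative Dc) (at u)" and De: "(e has_derivative De) (at u)"
    using assms(1,2)[OF u] unfolding differentiable_def by blast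
  have "De u = e u" using De hom[OF u] by (rule euler_homogeneous)
  moreover have "De (c u *\<^sub>R h + Dc h *\<^sub>R u) = c u * De h + Dc h * De u" for h
    using has_derivative_linear[OF De] by (simp add: linear_add linear_scale)
  ultimately have comp: "De \<circ> (\<lambda>h. c u *\<^sub>R h + Dc h *\<^sub>R u) = (\<lambda>h. c u * De h + Dc h * e u)"
    by (simp add: fun_eq_iff)
  have "((\<lambda>u. c u *\<^sub>R u) has_derivative (\<lambda>h. c u *\<^sub>R h + Dc h *\<^sub>R u)) (at u)"
    using Dc by (auto intro!: derivative_eq_intros)
  moreover have "((\<lambda>u. c u * e u) has_derivative (De \<circ> (\<lambda>h. c u *\<^sub>R h + Dc h *\<^sub>R u))) (at u)"
    unfolding comp using has_derivative_mult[OF Dc De] .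
  ultimately show "\<exists>Df D\<eta>. ((\<lambda>u. c u *\<^sub>R u) has_derivative Df) (at u) \<and>
      (e has_derivative D\<eta>) (at u) \<and> ((\<lambda>u. c u * e u) has_derivative (D\<eta> \<circ> Df)) (at u)"
    using De by blast
qed

subsection \<open>The system with states \<open>(\<rho>, z, w)\<close>\<close>

lemma open_states: "open states"
  unfolding states_def by (intro open_Collect_less continuous_intros)

lemma convex_states: "convex states"
  using convex_halfspace_gt[of 0 "axis 1 1 :: real ^ 3"] by (simp add: states_def inner_axis')

lemma C2_on_eta:
  assumes "C2_on F UNIV" shows "C2_on (\<eta> F) states"
proof -
  have "C2_on (\<lambda>u::real^3. inverse (u $ 1)) states"
    by (intro C2_on_compose[OF C2_on_inverse C2_on_linear] bounded_linear_vec_nth)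
      (auto simp: states_def)
  \<comment> \<open>Scaling the pair handles both ratios by a single bilinear product.\<close>
  then have "C2_on (\<lambda>u::real^3. inverse (u $ 1) *\<^sub>R (u $ 2, u $ 3)) states"
    by (rule bounded_bilinear.C2_on[OF bounded_bilinear_scaleR])
      (intro C2_on_linear bounded_linear_Pair bounded_linear_vec_nth)
  from C2_on_compose[OF assms this subset_UNIV]
  have "C2_on (\<lambda>u::real^3. F (inverse (u $ 1) *\<^sub>R (u $ 2, u $ 3))) states" .
  then have "C2_on (\<lambda>u::real^3. u $ 1 * F (inverse (u $ 1) *\<^sub>R (u $ 2, u $ 3))) states"
    by (rule bounded_bilinear.C2_on[OF bounded_bilinear_mult C2_on_linear[OF bounded_linear_vec_nth]])
  moreover have "\<eta> F = (\<lambda>u::real^3. u $ 1 * F (inverse (u $ 1) *\<^sub>R (u $ 2, u $ 3)))"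
    by (simp add: \<eta>_def fun_eq_iff divide_inverse mult.commute)
  ultimately show ?thesis by simp
qed

text \<open>\<open>\<eta> F\<close> is the perspective of \<open>F\<close>: the state variables of a mixture of two states average
  \<open>(z/\<rho>, w/\<rho>)\<close> with weights proportional to the densities.\<close>

lemma convex_on_eta:
  assumes "convex_on UNIV F" shows "convex_on states (\<eta> F)"
proof (rule convex_onI[OF _ convex_states])
  fix t :: real and x y :: "real ^ 3"
  assume t: "0 < t" "t < 1" and xy: "x \<in> states" "y \<in> states"
  \<comment> \<open>\<open>r\<close> is the density of the mixture, and \<open>\<theta>\<close>
    below is the share of it contributed by \<open>y\<close>.\<close>
  define r where "r = (1 - t) * x $ 1 + t * y $ 1"
  define \<theta> where "\<theta> = t * y $ 1 / r"
  have pos: "x $ 1 > 0" "y $ 1 > 0" using xy by (auto simp: states_def)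
  have r: "r > 0" using t pos by (simp add: r_def add_pos_pos)
  have th: "r * \<theta> = t * y $ 1" "r * (1 - \<theta>) = (1 - t) * x $ 1"
    using r by (auto simp: \<theta>_def r_def field_simps)
  have \<theta>: "0 \<le> \<theta>" "\<theta> \<le> 1"
    using t pos r by (auto simp: \<theta>_def r_def)
  have avg: "((1 - t) * x $ i + t * y $ i) / r = (1 - \<theta>) * (x $ i / x $ 1) + \<theta> * (y $ i / y $ 1)" for i
  proof -
    have "r * ((1 - \<theta>) * (x $ i / x $ 1) + \<theta> * (y $ i / y $ 1)) =
        (r * (1 - \<theta>)) * (x $ i / x $ 1) + (r * \<theta>) * (y $ i / y $ 1)"
      by (simp add: algebra_simps)
    also have "\<dots> = (1 - t) * x $ i + t * y $ i"
      unfolding th using pos by simp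
    finally show ?thesis using r by (simp add: field_simps)
  qed
  let ?X = "(x $ 2 / x $ 1, x $ 3 / x $ 1)" and ?Y = "(y $ 2 / y $ 1, y $ 3 / y $ 1)"
  have "\<eta> F ((1 - t) *\<^sub>R x + t *\<^sub>R y) = r * F ((1 - \<theta>) *\<^sub>R ?X + \<theta> *\<^sub>R ?Y)"
    using avg[of 2] avg[of 3] by (simp add: \<eta>_def r_def[symmetric])
  \<comment> \<open>Convexity of \<open>F\<close> enters here with weight \<open>\<theta>\<close>;
    the factor \<open>r\<close> then turns the weights back into \<open>(1 - t) * x $ 1\<close> and
    \<open>t * y $ 1\<close>.\<close>
  also have "\<dots> \<le> r * ((1 - \<theta>) * F ?X + \<theta> * F ?Y)"
    using convex_onD[OF assms \<theta>, of ?X ?Y] r by (intro mult_left_mono) auto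
  also have "\<dots> = (r * (1 - \<theta>)) * F ?X + (r * \<theta>) * F ?Y"
    by (simp add: algebra_simps)
  also have "\<dots> = (1 - t) * \<eta> F x + t * \<eta> F y"
    unfolding th \<eta>_def by simp
  finally show "\<eta> F ((1 - t) *\<^sub>R x + t *\<^sub>R y) \<le> (1 - t) * \<eta> F x + t * \<eta> F y" .
qed

text \<open>Positive density keeps the quotients and both branches of \<open>P\<close> away from
  their singularities.\<close>

lemma v_differentiable:
  assumes "\<And>x. a differentiable (at x)" "u \<in> states"
  shows "v \<gamma> a differentiable (at u)"
proof -
  have pos: "u $ 1 > 0" using assms(2) by (simp add: states_def)
  have nth: "(\<lambda>u::real^3. u $ i) differentiable (at u)" for i
    by (intro bounded_linear_imp_differentiable bounded_linear_vec_nth)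
  have "P \<gamma> differentiable (at (u $ 1))"
    unfolding P_def using pos
    by (cases "\<gamma> = 0") (auto simp: real_differentiable_def intro!: derivative_eq_intros)
  then have "(\<lambda>u::real^3. P \<gamma> (u $ 1)) differentiable (at u)"
    using nth[of 1] by (rule differentiable_compose)
  moreover have ratio: "(\<lambda>u::real^3. u $ i / u $ 1) differentiable (at u)" for i
    using pos by (intro differentiable_divide[OF nth nth]) simp
  moreover have "(\<lambda>u::real^3. a (u $ 3 / u $ 1)) differentiable (at u)"
    using assms(1) ratio by (rule differentiable_compose)
  ultimately have "(\<lambda>u::real^3. u $ 2 / u $ 1 - a (u $ 3 / u $ 1) * P \<gamma> (u $ 1)) differentiable (at u)"
    by (intro differentiable_diff[OF ratio] differentiable_mult)
  then show ?thesis
    unfolding v_def[abs_def] .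
qed

proposition exact_semi_convex_entropy_convex:
  assumes a: "\<And>x. a differentiable (at x)" and F: "C2_on F UNIV" "convex_on UNIV F"
  shows "exact_semi_convex_entropy \<gamma> a F"
proof -
  have "\<eta> F differentiable (at u)" if "u \<in> states" for u
    using C2_imp_C1[OF C2_on_eta[OF F(1)]] that
    by (auto elim: C1_imp_has_derivative simp: differentiable_def)
  \<comment> \<open>Scaling a state leaves both ratios in \<open>\<eta>\<close> fixed and multiplies
    only the prefactor, which is the required homogeneity.\<close>
  then have "entropy_pair (\<lambda>u. v \<gamma> a u *\<^sub>R u) states (\<eta> F) (\<lambda>u. v \<gamma> a u * \<eta> F u)"
    by (intro entropy_pair_transport v_differentiable a) (auto simp: \<eta>_def)
  then have pair: "entropy_pair (flux \<gamma> a) states (\<eta> F) (\<psi> \<gamma> a F)"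
    by (simp add: flux_def[abs_def] \<psi>_def[abs_def])
  show ?thesis
    unfolding exact_semi_convex_entropy_def
    using pair entropy_pair_imp_satisfies_entropy_eq[OF pair]
      convex_imp_semi_convex_on[OF open_states convex_on_eta[OF F(2)] C2_on_eta[OF F(1)]]
    by blast
qed

section \<open>From strict convexity to the listed choices of \<open>F\<close>\<close>

lemma strictly_convex_imp_convex_on:
  assumes "strictly_convex F" shows "convex_on UNIV F"
proof (rule convex_onI)
  fix t :: real and x y
  assume "0 < t" "t < 1"
  \<comment> \<open>Strict convexity speaks of distinct points only; for \<open>x = y\<close> both
    sides agree.\<close>
  then show "F ((1 - t) *\<^sub>R x + t *\<^sub>R y) \<le> (1 - t) * F x + t * F y"
    using assms by (cases "x = y") (auto simp: strictly_convex_def algebra_simps intro: less_imp_le)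
qed simp

lemma convex_on_compose_linear:
  assumes "convex_on UNIV f" "linear L" shows "convex_on UNIV (\<lambda>x. f (L x))"
  using assms by (auto simp: convex_on_def linear_add linear_scale)

theorem theorem3p4:
  fixes \<gamma> :: real and a :: "real \<Rightarrow> real"
  assumes "\<gamma> \<ge> 0" and "a C1_differentiable_on UNIV"
  shows
    "(\<forall>F :: real \<times> real \<Rightarrow> real. C2_on F UNIV \<and> strictly_convex F \<longrightarrow>
        exact_semi_convex_entropy \<gamma> a F) \<and>
     (\<forall>G :: real \<Rightarrow> real. C2_on G UNIV \<and> strictly_convex G \<longrightarrow>
        exact_semi_convex_entropy \<gamma> a (\<lambda>(\<omega>, h). G \<omega>) \<and>
        exact_semi_convex_entropy \<gamma> a (\<lambda>(\<omega>, h). G h)) \<and>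
     (\<forall>E :: real \<Rightarrow> real. C2_on E UNIV \<and> strictly_convex E \<longrightarrow>
        exact_semi_convex_entropy \<gamma> a (\<lambda>(\<omega>, h). 1 / 2 * \<omega>\<^sup>2 + E h) \<and>
        (\<forall>u\<in>states. \<eta> (\<lambda>(\<omega>, h). 1 / 2 * \<omega>\<^sup>2 + E h) u =
           (u $ 2)\<^sup>2 / (2 * u $ 1) + u $ 1 * E (u $ 3 / u $ 1)))"
proof (intro conjI allI impI ballI; (elim conjE)?)
  have a: "a differentiable (at x)" for x
    using assms(2) by (auto simp: C1_differentiable_on_eq)
  note main = exact_semi_convex_entropy_convex[OF a]
  \<comment> \<open>Regularity and convexity pull back along the coordinate projections; the third
    choice is a sum of two such pullbacks.\<close>
  have proj: "C2_on (\<lambda>p. G (fst p)) UNIV" "C2_on (\<lambda>p. G (snd p)) UNIV"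
    "convex_on UNIV (\<lambda>p. G (fst p))" "convex_on UNIV (\<lambda>p. G (snd p))"
    if "C2_on G UNIV" "convex_on UNIV G" for G :: "real \<Rightarrow> real"
    using that C2_on_compose[OF that(1) C2_on_linear[OF bounded_linear_fst] subset_UNIV]
      C2_on_compose[OF that(1) C2_on_linear[OF bounded_linear_snd] subset_UNIV]
    by (simp_all add: convex_on_compose_linear linear_fst linear_snd)
  {
    fix F :: "real \<times> real \<Rightarrow> real" assume "C2_on F UNIV" "strictly_convex F"
    then show "exact_semi_convex_entropy \<gamma> a F"
      by (rule main[OF _ strictly_convex_imp_convex_on])
  }
  {
    fix G :: "real \<Rightarrow> real" assume "C2_on G UNIV" "strictly_convex G"
    note G = proj[OF this(1) strictly_convex_imp_convex_on[OF this(2)]]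
    show "exact_semi_convex_entropy \<gamma> a (\<lambda>(\<omega>, h). G \<omega>)"
      unfolding case_prod_unfold by (rule main[OF G(1,3)])
    show "exact_semi_convex_entropy \<gamma> a (\<lambda>(\<omega>, h). G h)"
      unfolding case_prod_unfold by (rule main[OF G(2,4)])
  }
  {
    fix E :: "real \<Rightarrow> real" assume "C2_on E UNIV" "strictly_convex E"
    note E = proj[OF this(1) strictly_convex_imp_convex_on[OF this(2)]]
    have id: "C2_on (\<lambda>\<omega>::real. \<omega>) UNIV"
      by (rule C2_on_linear[OF bounded_linear_ident])
    have "C2_on (\<lambda>\<omega>::real. 1 / 2 * (\<omega> * \<omega>)) UNIV"
      by (rule bounded_bilinear.C2_on[OF bounded_bilinear_mult C2_on_const
          bounded_bilinear.C2_on[OF bounded_bilinear_mult id id]])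
    then have sq: "C2_on (\<lambda>\<omega>::real. 1 / 2 * \<omega>\<^sup>2) UNIV"
      by (simp add: power2_eq_square)
    \<comment> \<open>The derivative is the identity, which is monotone.\<close>
    have sq_convex: "convex_on UNIV (\<lambda>\<omega>::real. 1 / 2 * \<omega>\<^sup>2)"
      by (rule convex_on_realI[where f' = "\<lambda>\<omega>. \<omega>"]) (auto intro!: derivative_eq_intros)
    show "exact_semi_convex_entropy \<gamma> a (\<lambda>(\<omega>, h). 1 / 2 * \<omega>\<^sup>2 + E h)"
      unfolding case_prod_unfold
      by (rule main[OF C2_on_add[OF proj(1)[OF sq sq_convex] E(2)]
            convex_on_add[OF proj(3)[OF sq sq_convex] E(4)]])
    fix u :: "real ^ 3" assume "u \<in> states"
    then show "\<eta> (\<lambda>(\<omega>, h). 1 / 2 * \<omega>\<^sup>2 + E h) u =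
        (u $ 2)\<^sup>2 / (2 * u $ 1) + u $ 1 * E (u $ 3 / u $ 1)"
      by (simp add: \<eta>_def states_def field_simps power2_eq_square)
  }
qed

end
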